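(* Let $R\in O(\mathbb R^D)$ and let $\mu$ be a measure with the linear isometry invariance $d\mu(x)=d\mu(Rx)$. If the times are restricted to belong to the symmetric algebra of the fixed point subspace $V_R=\{v\in\mathbb R^D:Rv=v\}$, i.e. $t^\top\in\operatorname{Sym}(V_R)\subset\operatorname{Sym}(\mathbb R^D)$, then the invariance of the measure is preserved along the flow: $$d\mu_t(x)=d\mu_t(Rx)\qquad\forall t^\top\in\operatorname{Sym}(V_R).$$
   Context: Let $D\ge1$ and let $\mu$ be a Borel measure on $\mathbb R^D$; $d\mu(x)=d\mu(Rx)$ means $\mu(R^{-1}(A))=\mu(A)$ for all measurable $A$. The times are $t=(t_{[0]},t_{[1]},\dots)$ with $t_{[k]}=(t_\alpha)_{\alpha\in[k]}$ a row vector of real numbers, where $[k]=\{\alpha\in\mathbb Z_+^D:|\alpha|=k\}$. The deformed measure is $$d\mu_t(x)=e^{t(x)}d\mu(x),\qquad t(x)=\sum_{k\ge0}\sum_{\alpha\in[k]}t_\alpha x^\alpha.$$ Times are identified with elements of the symmetric algebra $\operatorname{Sym}(\mathbb R^D)=\bigoplus_{k\ge0}(\mathbb R^D)^{\odot k}$: $t_{[k]}^\top$ is the coordinate column, in the basis $e^\alpha=e_1^{\odot\alpha_1}\odot\cdots\odot e_D^{\odot\alpha_D}$, $\alpha\in[k]$, of the symmetric tensor $\sum_{\alpha\in[k]}t_\alpha e^\alpha\in(\mathbb R^D)^{\odot k}$ (here $e_a$ is the canonical basis of $\mathbb R^D$ and $\odot$ the symmetric product). The condition $t^\top\in\operatorname{Sym}(V_R)$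 means that for each $k$ this symmetric tensor lies in $(V_R)^{\odot k}$, the span of $v_1\odot\cdots\odot v_k$ with $v_i\in V_R$. *)

theory Defs
  imports "HOL-Analysis.Analysis"
begin

text \<open>
  \<open>\<real>\<^sup>D\<close> is \<open>real ^ 'n\<close> with \<open>D = CARD('n) \<ge> 1\<close>, and multi-indices in \<open>\<int>\<^sub>+\<^sup>D\<close> are
  functions \<open>'n \<Rightarrow> nat\<close>.
\<close>

definition multi_indices :: "nat \<Rightarrow> ('n::finite \<Rightarrow> nat) set"
  where "multi_indices k = {\<alpha>. (\<Sum>a\<in>UNIV. \<alpha> a) = k}"

definition monomial :: "('n::finite \<Rightarrow> nat) \<Rightarrow> real ^ 'n \<Rightarrow> real"
  where "monomial \<alpha> x = (\<Prod>a\<in>UNIV. (x $ a) ^ \<alpha> a)"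

text \<open>
  Times are arbitrary families of reals. Where the series below converges (always, if only
  finitely many times are nonzero) it is \<open>t(x)\<close>; elsewhere \<^const>\<open>suminf\<close> is an unspecified
  constant.
\<close>

definition flow_fun :: "(('n::finite \<Rightarrow> nat) \<Rightarrow> real) \<Rightarrow> real ^ 'n \<Rightarrow> real"
  where "flow_fun t x = (\<Sum>k. \<Sum>\<alpha>\<in>multi_indices k. t \<alpha> * monomial \<alpha> x)"

definition deformed_measure ::
    "(('n::finite \<Rightarrow> nat) \<Rightarrow> real) \<Rightarrow> (real ^ 'n) measure \<Rightarrow> (real ^ 'n) measure"
  where "deformed_measure t \<mu> = density \<mu> (\<lambda>x. ennreal (exp (flow_fun t x)))"

definition isometry_invariant :: "('a \<Rightarrow> 'a) \<Rightarrow> 'a measure \<Rightarrow> bool"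
  where "isometry_invariant R \<mu> \<longleftrightarrow> (\<forall>A\<in>sets \<mu>. emeasure \<mu> (R -` A) = emeasure \<mu> A)"

definition fixed_space :: "('a \<Rightarrow> 'a) \<Rightarrow> 'a set"
  where "fixed_space R = {v. R v = v}"

text \<open>
  A tensor of degree \<open>k\<close> over \<open>\<real>\<^sup>D\<close> is given by its components \<open>T i\<close> for index tuples
  \<open>(i 0, \<dots>, i (k - 1))\<close>; \<open>T i\<close> does not depend on the values of \<open>i\<close> outside \<open>{..<k}\<close>.
  Symmetric products are taken over a finite index set \<open>J\<close> of cardinality \<open>k\<close>, as the average
  of the tensors \<open>v (\<pi> 0) \<otimes> \<dots> \<otimes> v (\<pi> (k - 1))\<close> over all enumerations \<open>\<pi>\<close> of \<open>J\<close>; for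
  \<open>J = {..<k}\<close> this is \<open>v 0 \<odot> \<dots> \<odot> v (k - 1)\<close>. Omitting the factor \<open>1/k!\<close> would rescale
  each degree as a whole and so not affect the predicate \<open>times_in_Sym\<close> below.
\<close>

type_synonym 'n tensor = "(nat \<Rightarrow> 'n) \<Rightarrow> real"

definition sym_prod :: "'j set \<Rightarrow> ('j \<Rightarrow> real ^ 'n) \<Rightarrow> 'n::finite tensor"
  where "sym_prod J v = (\<lambda>i.
    (\<Sum>\<pi> \<in> {\<pi> \<in> {..<card J} \<rightarrow>\<^sub>E J. bij_betw \<pi> {..<card J} J}.
       \<Prod>s<card J. v (\<pi> s) $ i s) / fact (card J))"

text \<open>
  \<open>e\<^sup>\<alpha>\<close>: the symmetric product in which each basis vector \<open>e\<^sub>a\<close> occurs \<open>\<alpha> a\<close> times, the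
  occurrences being labelled \<open>(a, 0), \<dots>, (a, \<alpha> a - 1)\<close>.
\<close>

definition basis_sym_tensor :: "('n::finite \<Rightarrow> nat) \<Rightarrow> 'n tensor"
  where "basis_sym_tensor \<alpha> = sym_prod (SIGMA a:UNIV. {..<\<alpha> a}) (\<lambda>(a, _). axis a 1)"

definition times_tensor :: "(('n::finite \<Rightarrow> nat) \<Rightarrow> real) \<Rightarrow> nat \<Rightarrow> 'n tensor"
  where "times_tensor t k = (\<lambda>i. \<Sum>\<alpha>\<in>multi_indices k. t \<alpha> * basis_sym_tensor \<alpha> i)"

text \<open>
  The linear span of the \<open>k\<close>-fold symmetric products of vectors in \<open>V\<close>, spelled out because
  function types are not an instance of \<^class>\<open>real_vector\<close>.
\<close>

definition sym_power :: "nat \<Rightarrow> (real ^ 'n) set \<Rightarrow> 'n::finite tensor set"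
  where "sym_power k V = {T. \<exists>(m::nat) (c :: nat \<Rightarrow> real) v.
    (\<forall>j<m. \<forall>s<k. v j s \<in> V) \<and> T = (\<lambda>i. \<Sum>j<m. c j * sym_prod {..<k} (v j) i)}"

text \<open>
  Membership in \<open>Sym(V)\<close> is required degree by degree; that only finitely many
  degrees are nonzero is not imposed.
\<close>

definition times_in_Sym :: "(('n::finite \<Rightarrow> nat) \<Rightarrow> real) \<Rightarrow> (real ^ 'n) set \<Rightarrow> bool"
  where "times_in_Sym t V \<longleftrightarrow> (\<forall>k. times_tensor t k \<in> sym_power k V)"

end

theory Submission
  imports Defs "HOL-Combinatorics.Permutations"
begin

text \<open>
  Contracting a symmetric tensor of degree \<open>k\<close> with \<open>x\<^sup>\<otimes>\<^sup>k\<close> turns the symmetric product of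
  \<open>v\<^sub>1, \<dots>, v\<^sub>k\<close> into \<open>\<Prod>\<^sub>s (v\<^sub>s \<bullet> x)\<close>, and \<open>e\<^sup>\<alpha>\<close> into \<open>x\<^sup>\<alpha>\<close>. Hence, if the times lie in
  \<open>Sym(V\<^sub>R)\<close>, each homogeneous part of \<open>t(x)\<close> is a combination of products of linear forms
  \<open>v \<bullet> x\<close> with \<open>R v = v\<close>, and \<open>v \<bullet> R x = R v \<bullet> R x = v \<bullet> x\<close>. So \<open>t(R x) = t(x)\<close>, and a density
  invariant under \<open>R\<close> preserves the invariance of the measure.
\<close>

definition contract :: "nat \<Rightarrow> 'n::finite tensor \<Rightarrow> real ^ 'n \<Rightarrow> real"
  where "contract k T x = (\<Sum>i \<in> {..<k} \<rightarrow>\<^sub>E UNIV. T i * (\<Prod>s<k. x $ i s))"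

lemma contract_sum:
  "contract k (\<lambda>i. \<Sum>j\<in>J. c j * T j i) x = (\<Sum>j\<in>J. c j * contract k (T j) x)"
  unfolding contract_def sum_distrib_left sum_distrib_right
  by (subst sum.swap) (simp add: mult.assoc)

text \<open>Relative to one fixed enumeration \<open>e\<close>, every enumeration of
  \<open>J\<close> is \<open>p \<circ> e\<close> on the index range for exactly one permutation
  \<open>p\<close> of \<open>J\<close>. The count cancels the factor 1/k! in
  \<open>sym_prod\<close>.\<close>

lemma card_bij_betw_PiE:
  assumes "finite J"
  shows "card {\<pi> \<in> {..<card J} \<rightarrow>\<^sub>E J. bij_betw \<pi> {..<card J} J} = fact (card J)"
proof -
  let ?I = "{..<card J}"
  obtain e where e: "bij_betw e ?I J"
    using assms by (metis bij_betw_from_nat_into_finite)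
  define d where "d = inv_into ?I e"
  have d: "bij_betw d J ?I"
    unfolding d_def using e by (rule bij_betw_inv_into)
  have ed: "e (d x) = x" if "x \<in> J" for x
    using e that by (simp add: d_def bij_betw_inv_into_right)
  have de: "d (e s) = s" if "s \<in> ?I" for s
    using e that by (simp add: d_def bij_betw_inv_into_left)
  have eI: "e s \<in> J" if "s \<in> ?I" for s
    using e that by (rule bij_betw_apply)
  have dJ: "d x \<in> ?I" if "x \<in> J" for x
    using d that by (rule bij_betw_apply)
  have "bij_betw (\<lambda>p. restrict (p \<circ> e) ?I) {p. p permutes J}
      {\<pi> \<in> ?I \<rightarrow>\<^sub>E J. bij_betw \<pi> ?I J}"
  \<comment> \<open>The inverse sends \<open>\<pi>\<close> to \<open>\<pi> \<circ> d\<close>, where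
    \<open>d\<close> undoes \<open>e\<close>. Off \<open>J\<close> it must be the identity, as
    \<open>permutes\<close> demands; off \<open>?I\<close>, \<open>restrict\<close> supplies the
    default value that \<open>\<rightarrow>\<^sub>E\<close> demands.\<close>
  proof (rule bij_betw_byWitness[where f' = "\<lambda>\<pi> x. if x \<in> J then \<pi> (d x) else x"])
    show "\<forall>p\<in>{p. p permutes J}. (\<lambda>x. if x \<in> J then restrict (p \<circ> e) ?I (d x) else x) = p"
    proof (intro ballI ext)
      fix p x
      assume "p \<in> {p. p permutes J}"
      then show "(if x \<in> J then restrict (p \<circ> e) ?I (d x) else x) = p x"
        using dJ[of x] by (simp add: ed permutes_not_in)
    qed
    show "\<forall>\<pi>\<in>{\<pi> \<in> ?I \<rightarrow>\<^sub>E J. bij_betw \<pi> ?I J}.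
        restrict ((\<lambda>x. if x \<in> J then \<pi> (d x) else x) \<circ> e) ?I = \<pi>"
    proof
      fix \<pi>
      assume "\<pi> \<in> {\<pi> \<in> ?I \<rightarrow>\<^sub>E J. bij_betw \<pi> ?I J}"
      then have "\<pi> \<in> extensional ?I"
        by (simp add: PiE_def)
      then show "restrict ((\<lambda>x. if x \<in> J then \<pi> (d x) else x) \<circ> e) ?I = \<pi>"
        by (rule extensionalityI[OF restrict_extensional]) (use eI de in simp)
    qed
    show "(\<lambda>p. restrict (p \<circ> e) ?I) ` {p. p permutes J} \<subseteq> {\<pi> \<in> ?I \<rightarrow>\<^sub>E J. bij_betw \<pi> ?I J}"
    proof (rule image_subsetI)
      fix p
      assume "p \<in> {p. p permutes J}"
      then have p: "p permutes J"
        by simp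
      have "bij_betw (restrict (p \<circ> e) ?I) ?I J"
        using bij_betw_trans[OF e permutes_imp_bij[OF p]]
        by (subst bij_betw_cong[where g = "p \<circ> e"]) auto
      moreover have "restrict (p \<circ> e) ?I \<in> ?I \<rightarrow>\<^sub>E J"
        using eI by (simp add: permutes_in_image[OF p])
      ultimately show "restrict (p \<circ> e) ?I \<in> {\<pi> \<in> ?I \<rightarrow>\<^sub>E J. bij_betw \<pi> ?I J}"
        by simp
    qed
    show "(\<lambda>\<pi> x. if x \<in> J then \<pi> (d x) else x) ` {\<pi> \<in> ?I \<rightarrow>\<^sub>E J. bij_betw \<pi> ?I J}
        \<subseteq> {p. p permutes J}"
    proof safe
      fix \<pi>
      assume "bij_betw \<pi> ?I J"
      then have "bij_betw (\<pi> \<circ> d) J J"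
        using d by (rule bij_betw_trans[rotated])
      then have "bij_betw (\<lambda>x. if x \<in> J then \<pi> (d x) else x) J J"
        by (simp cong: bij_betw_cong)
      then show "(\<lambda>x. if x \<in> J then \<pi> (d x) else x) permutes J"
        by (rule bij_imp_permutes) simp
    qed
  qed
  then show ?thesis
    using card_permutations[OF refl assms] by (simp add: bij_betw_same_card)
qed

text \<open>All enumerations of \<open>J\<close> contribute the same product, so averaging over them
  returns it. An arbitrary finite \<open>J\<close> serves both \<open>{..<k}\<close> and the
  labelled occurrences in \<open>basis_sym_tensor\<close>.\<close>

lemma contract_sym_prod:
  fixes v :: "'j \<Rightarrow> real ^ 'n"
  assumes J: "finite J"
  shows "contract (card J) (sym_prod J v) x = (\<Prod>j\<in>J. v j \<bullet> x)"
proof -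
  define k where "k = card J"
  define B where "B = {\<pi> \<in> {..<k} \<rightarrow>\<^sub>E J. bij_betw \<pi> {..<k} J}"
  have "contract k (sym_prod J v) x
      = (\<Sum>i \<in> {..<k} \<rightarrow>\<^sub>E UNIV. \<Sum>\<pi>\<in>B. \<Prod>s<k. v (\<pi> s) $ i s * x $ i s) / fact k"
    by (simp add: contract_def sym_prod_def flip: k_def B_def)
      (simp add: sum_divide_distrib sum_distrib_right prod.distrib)
  also have "\<dots> = (\<Sum>\<pi>\<in>B. \<Sum>i \<in> {..<k} \<rightarrow>\<^sub>E UNIV. \<Prod>s<k. v (\<pi> s) $ i s * x $ i s) / fact k"
    by (subst sum.swap) simp
  \<comment> \<open>The entries of an index tuple vary independently, so the sum of products factors
    into a product of sums over a single entry, and these are inner products.\<close>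
  also have "\<dots> = (\<Sum>\<pi>\<in>B. \<Prod>s<k. v (\<pi> s) \<bullet> x) / fact k"
    by (simp add: inner_vec_def prod_sum_PiE)
  also have "\<dots> = (\<Sum>\<pi>\<in>B. \<Prod>j\<in>J. v j \<bullet> x) / fact k"
    by (simp add: B_def prod.reindex_bij_betw[of _ "{..<k}" J "\<lambda>j. v j \<bullet> x"])
  also have "\<dots> = (\<Prod>j\<in>J. v j \<bullet> x)"
    using card_bij_betw_PiE[OF J] by (simp add: B_def k_def)
  finally show ?thesis
    by (simp add: k_def)
qed

lemma contract_basis_sym_tensor:
  assumes "\<alpha> \<in> multi_indices k"
  shows "contract k (basis_sym_tensor \<alpha>) x = monomial \<alpha> x"
proof -
  have "card (SIGMA a:UNIV. {..<\<alpha> a}) = k"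
    using assms by (simp add: multi_indices_def)
  then have "contract k (basis_sym_tensor \<alpha>) x
      = (\<Prod>(a, r)\<in>(SIGMA a:UNIV. {..<\<alpha> a}). axis a 1 \<bullet> x)"
    using contract_sym_prod[of "SIGMA a:UNIV. {..<\<alpha> a}" "\<lambda>(a, _). axis a 1" x]
    by (simp add: basis_sym_tensor_def case_prod_unfold)
  \<comment> \<open>The \<open>\<alpha> a\<close> labels \<open>r\<close> attached to
    \<open>a\<close> all give the factor \<open>x $ a\<close>, hence its power.\<close>
  also have "\<dots> = monomial \<alpha> x"
    by (subst prod.Sigma[symmetric]) (simp_all add: monomial_def inner_axis')
  finally show ?thesis .
qed

text \<open>Links the tensor condition on the times to the degree-k part of t(x).\<close>

lemma contract_times_tensor:
  "contract k (times_tensor t k) x = (\<Sum>\<alpha>\<in>multi_indices k. t \<alpha> * monomial \<alpha> x)"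
  unfolding times_tensor_def contract_sum by (simp add: contract_basis_sym_tensor)

lemma contract_sym_power_fixed_space:
  assumes R: "orthogonal_transformation R" and T: "T \<in> sym_power k (fixed_space R)"
  shows "contract k T (R x) = contract k T x"
proof -
  obtain m c v where v: "\<forall>j<m. \<forall>s<k. v j s \<in> fixed_space R"
    and T_eq: "T = (\<lambda>i. \<Sum>j<(m::nat). c j * sym_prod {..<k} (v j) i)"
    using T unfolding sym_power_def by auto
  \<comment> \<open>By linearity, the contraction sees \<open>y\<close> only through linear forms
    given by vectors that \<open>R\<close> fixes.\<close>
  have contract_T: "contract k T y = (\<Sum>j<m. c j * (\<Prod>s<k. v j s \<bullet> y))" for y
    by (simp add: T_eq contract_sum contract_sym_prod[of "{..<k}", simplified])
  have "v j s \<bullet> R x = v j s \<bullet> x" if "j < m" "s < k" for j s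
  proof -
    have "R (v j s) = v j s"
      using v that by (simp add: fixed_space_def)
    then show ?thesis
      using R by (metis orthogonal_transformation_def)
  qed
  then show ?thesis
    by (simp add: contract_T)
qed

text \<open>The two series agree degree by degree, so their \<open>suminf\<close> values agree at
  points of divergence as well.\<close>

lemma flow_fun_invariant:
  assumes "orthogonal_transformation R" and "times_in_Sym t (fixed_space R)"
  shows "flow_fun t (R x) = flow_fun t x"
  using assms contract_sym_power_fixed_space[OF assms(1), of "times_tensor t _" _ x]
  by (simp add: flow_fun_def times_in_Sym_def flip: contract_times_tensor)

text \<open>Each homogeneous part is a polynomial; the set where the series converges is Borel, and
  \<open>suminf\<close> is constant off it.\<close>

lemma borel_measurable_flow_fun: "flow_fun t \<in> borel_measurable borel"
  unfolding flow_fun_def monomial_def by measurable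

text \<open>The pushforward form lets invariance be combined with change of variables for
  densities.\<close>

lemma isometry_invariant_iff_distr:
  assumes "R \<in> measurable \<mu> \<mu>" and "space \<mu> = UNIV"
  shows "isometry_invariant R \<mu> \<longleftrightarrow> distr \<mu> \<mu> R = \<mu>"
proof
  assume "isometry_invariant R \<mu>"
  then show "distr \<mu> \<mu> R = \<mu>"
    using assms by (intro measure_eqI) (auto simp: emeasure_distr isometry_invariant_def)
next
  assume "distr \<mu> \<mu> R = \<mu>"
  then show "isometry_invariant R \<mu>"
    unfolding isometry_invariant_def using assms
    by (metis emeasure_distr inf_top.right_neutral)
qed

text \<open>Pushing forward a measure with density \<open>f \<circ> R\<close> gives the pushforward
  measure with density \<open>f\<close>. Invariance of \<open>f\<close> provides the first form, and
  invariance of \<open>\<mu>\<close> reduces the second to \<open>density \<mu> f\<close>.\<close>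

lemma isometry_invariant_density:
  assumes R: "R \<in> measurable \<mu> \<mu>" and \<mu>: "space \<mu> = UNIV"
    and inv: "isometry_invariant R \<mu>"
    and f: "f \<in> borel_measurable \<mu>" and f_inv: "\<And>x. f (R x) = f x"
  shows "isometry_invariant R (density \<mu> f)"
proof -
  have "distr (density \<mu> f) (density \<mu> f) R = distr (density \<mu> (\<lambda>x. f (R x))) \<mu> R"
    by (intro distr_cong) (simp_all add: f_inv)
  also have "\<dots> = density (distr \<mu> \<mu> R) f"
    using density_distr[OF f R] by simp
  also have "\<dots> = density \<mu> f"
    using inv isometry_invariant_iff_distr[OF R \<mu>] by simp
  finally show ?thesis
    using R \<mu> by (subst isometry_invariant_iff_distr) simp_all
qed

theorem proposition6p4p3:
  fixes R :: "real ^ 'n \<Rightarrow> real ^ 'n"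
    and \<mu> :: "(real ^ 'n) measure"
  assumes "orthogonal_transformation R"
    and "sets \<mu> = sets borel"
    and "isometry_invariant R \<mu>"
  shows "\<forall>t. times_in_Sym t (fixed_space R) \<longrightarrow> isometry_invariant R (deformed_measure t \<mu>)"
proof (intro allI impI)
  fix t
  assume t: "times_in_Sym t (fixed_space R)"
  have "linear R"
    using assms(1) by (simp add: orthogonal_transformation_def)
  then have "R \<in> borel_measurable borel"
    by (intro borel_measurable_continuous_onI linear_continuous_on)
      (simp add: linear_conv_bounded_linear)
  then have "R \<in> measurable \<mu> \<mu>"
    using assms(2) by (simp cong: measurable_cong_sets)
  moreover have "space \<mu> = UNIV"
    using sets_eq_imp_space_eq[OF assms(2)] by simp
  moreover have "(\<lambda>x. ennreal (exp (flow_fun t x))) \<in> borel_measurable \<mu>"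
    using borel_measurable_flow_fun[of t] assms(2) by (simp cong: measurable_cong_sets)
  ultimately show "isometry_invariant R (deformed_measure t \<mu>)"
    unfolding deformed_measure_def using assms(3)
    by (intro isometry_invariant_density) (simp_all add: flow_fun_invariant[OF assms(1) t])
qed

end
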